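(* Let $P\ge1$, $r_1,\dots,r_P\ge1$, $m_1,\dots,m_P\ge2$, $\eta_1,\eta_2,T\ge1$ be integers and $r=\sum_{p=1}^Pr_p\ge2$. Consider the computing network whose file placement and function assignment are those of the hypercuboid design with these parameters (Node Grouping 2, NG File Mapping, Function Assignment 2). Let $L^*$ be the infimum of the communication load over all possible Shuffle phases for this network. Then $$L_{\rm c}\le\frac{2r}{r-1}L^*,$$ where $L_{\rm c}=\frac1{r-1}\cdot\frac{r}{\sum_{p=1}^P\frac{r_pm_p}{m_p-1}}$ is the communication load achieved by the NG Shuffle Method.
   Context: Model. There are $K$ nodes $[K]=\{1,\dots,K\}$, $N$ files $w_1,\dots,w_N$ and $Q$ functions. For $i\in[Q]$, $j\in[N]$ there is an intermediate value (IV) $v_{i,j}\in\{0,1\}^T$, computable from file $w_j$; function $i$ is computed from $v_{i,1},\dots,v_{i,N}$. The IVs are modelled as independent random variables uniform on $\{0,1\}^T$. Node $k$ has files $\mathcal M_k$, computes all IVs $v_{i,j}$ with $i\in[Q]$, $w_j\in\mathcal M_k$, and must compute the functions in $\mathcal W_k\subseteq[Q]$. Shuffle phase (scheme): each node $k$ broadcasts to all nodes a bit string $X_k$ of some fixed length $\ell_k$ that is a function of the IVs computed by node $k$, such that every node $k$ can determine all of $\{v_{i,j}:i\in\mathcal W_k,j\in[N]\}$ from $(X_1,\dots,X_K)$ and the IVs it computed. Its communication load is $\frac1{QNT}\sum_k\ell_k$. Node Grouping 2. The node set $[K]$ is partitioned into $\mathcal C_1,\dots,\mathcal C_P$, and each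 $\mathcal C_p$ is partitioned into $r_p$ subsets of size $m_p$; so $K=\sum_pr_pm_p$. Altogether this gives $r=\sum_pr_p$ sets $\mathcal K_1,\dots,\mathcal K_r$ partitioning $[K]$ (those numbered $r_1+\dots+r_{p-1}+1,\dots,r_1+\dots+r_p$ partition $\mathcal C_p$). A node group is a set of $r$ nodes containing exactly one node from each $\mathcal K_i$, $i\in[r]$; there are $X=\prod_{p=1}^Pm_p^{r_p}$ node groups $\mathcal T_1,\dots,\mathcal T_X$; $\mathcal T_{j,i}$ denotes the unique node in $\mathcal T_j\cap\mathcal K_i$. NG File Mapping. $N=\eta_1X$; the files are partitioned into sets $\mathcal B_1,\dots,\mathcal B_X$ of size $\eta_1$, and $\mathcal M_k=\bigcup_{i:\,k\in\mathcal T_i}\mathcal B_i$. Function Assignment 2. Let $Y$ be the least common multiple of $m_1-1,\dots,m_P-1$. Then $Q=\eta_2Y\sum_{p=1}^P\frac{r_pm_p}{m_p-1}$, and $[Q]$ is partitioned into $\mathcal W_1,\dots,\mathcal W_K$ with $|\mathcal W_k|=\frac{\eta_2Y}{m_p-1}$ for $k\in\mathcal C_p$. NG Shuffle Method. For $\alpha\in[X]$ and $z\in\mathcal T_\alpha$ with $z\in\mathcal K_h$, let $\mathcal L_{z,\alpha}=\{\ell\in[X]:\mathcal T_{\ell,h}\neq z,\ \mathcal T_{\ell,i}=\mathcal T_{\alpha,i}\ \forall i\in[r]\setminus\{h\}\}$ and $\mathcal V^{\{z\}}_{\mathcal T_\alpha\setminus z}=\bigcup_{\ell\in\mathcal L_{z,\alpha}}\{v_{i,j}: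 i\in\mathcal W_z,\ w_j\in\mathcal B_\ell\}$. The IVs of $\mathcal V^{\{z\}}_{\mathcal T_\alpha\setminus z}$ are concatenated into one bit string, split into $r-1$ segments of equal length $\mathcal V^{\{z\},\sigma}_{\mathcal T_\alpha\setminus z}$, $\sigma\in\mathcal T_\alpha\setminus\{z\}$ (assuming divisibility of the bit length by $r-1$). For every $\alpha\in[X]$ and $k\in\mathcal T_\alpha$, node $k$ multicasts the bitwise XOR $\bigoplus_{z\in\mathcal T_\alpha\setminus\{k\}}\mathcal V^{\{z\},k}_{\mathcal T_\alpha\setminus z}$. Its communication load is given by the formula for $L_{\rm c}$ in the claim, which may be taken as the definition of $L_{\rm c}$. *)

theory Defs
  imports "HOL-Probability.Probability" "HOL-Probability.Product_PMF"
begin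

section \<open>Computing networks and Shuffle phases\<close>

text \<open>
  A computing network has nodes \<open>{1..K}\<close>, files \<open>{1..N}\<close>, functions \<open>{1..Q}\<close>, IVs of \<open>T\<close> bits,
  placement \<open>M k \<subseteq> {1..N}\<close> (indices of the files at node \<open>k\<close>) and assignment \<open>W k \<subseteq> {1..Q}\<close>.
  A realisation of the IVs is a map \<open>v\<close> with \<open>v (i, j)\<close> the bit string of function \<open>i\<close> and file \<open>j\<close>.
\<close>

type_synonym iv_family = "nat \<times> nat \<Rightarrow> bool list"

definition iv_pmf :: "nat \<Rightarrow> nat \<Rightarrow> nat \<Rightarrow> iv_family pmf" where
  "iv_pmf N Q T = Pi_pmf ({1..Q} \<times> {1..N}) [] (\<lambda>_. pmf_of_set {b :: bool list. length b = T})"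

definition computed_ivs :: "nat \<Rightarrow> (nat \<Rightarrow> nat set) \<Rightarrow> nat \<Rightarrow> iv_family \<Rightarrow> iv_family" where
  "computed_ivs Q M k v = restrict v ({1..Q} \<times> M k)"

text \<open>
  Both restrictions matter: encoder \<open>k\<close> sees only the IVs computed by node \<open>k\<close>, and the decoders see
  only the messages of the \<open>K\<close> actual nodes. As the IV distribution is discrete, statements
  about all points of its support are exactly the statements holding with probability one.
\<close>

definition broadcasts ::
  "nat \<Rightarrow> nat \<Rightarrow> (nat \<Rightarrow> nat set) \<Rightarrow> (nat \<Rightarrow> iv_family \<Rightarrow> bool list) \<Rightarrow> iv_family \<Rightarrow> nat \<Rightarrow> bool list"
where
  "broadcasts K Q M enc v = restrict (\<lambda>k. enc k (computed_ivs Q M k v)) {1..K}"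

definition shuffle_scheme ::
  "nat \<Rightarrow> nat \<Rightarrow> nat \<Rightarrow> nat \<Rightarrow> (nat \<Rightarrow> nat set) \<Rightarrow> (nat \<Rightarrow> nat set) \<Rightarrow>
   (nat \<Rightarrow> nat) \<Rightarrow> (nat \<Rightarrow> iv_family \<Rightarrow> bool list) \<Rightarrow> bool"
where
  "shuffle_scheme K N Q T M W len enc \<longleftrightarrow>
     (\<forall>k\<in>{1..K}. \<forall>v\<in>set_pmf (iv_pmf N Q T). length (broadcasts K Q M enc v k) = len k) \<and>
     (\<forall>k\<in>{1..K}. \<exists>dec :: (nat \<Rightarrow> bool list) \<Rightarrow> iv_family \<Rightarrow> iv_family.
        \<forall>v\<in>set_pmf (iv_pmf N Q T). \<forall>i\<in>W k. \<forall>j\<in>{1..N}.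
          dec (broadcasts K Q M enc v) (computed_ivs Q M k v) (i, j) = v (i, j))"

definition comm_load :: "nat \<Rightarrow> nat \<Rightarrow> nat \<Rightarrow> nat \<Rightarrow> (nat \<Rightarrow> nat) \<Rightarrow> real" where
  "comm_load K N Q T len = 1 / (real Q * real N * real T) * (\<Sum>k=1..K. real (len k))"

definition optimal_load ::
  "nat \<Rightarrow> nat \<Rightarrow> nat \<Rightarrow> nat \<Rightarrow> (nat \<Rightarrow> nat set) \<Rightarrow> (nat \<Rightarrow> nat set) \<Rightarrow> real"
where
  "optimal_load K N Q T M W =
     Inf {comm_load K N Q T len | len. \<exists>enc. shuffle_scheme K N Q T M W len enc}"

section \<open>The hypercuboid design\<close>

definition indexed_partition :: "'i set \<Rightarrow> ('i \<Rightarrow> 'a set) \<Rightarrow> 'a set \<Rightarrow> bool" where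
  "indexed_partition I A U \<longleftrightarrow>
     disjoint_family_on A I \<and> (\<Union>i\<in>I. A i) = U \<and> (\<forall>i\<in>I. A i \<noteq> {})"

definition total_r :: "nat \<Rightarrow> (nat \<Rightarrow> nat) \<Rightarrow> nat" where
  "total_r P rs = (\<Sum>p=1..P. rs p)"

definition num_nodes :: "nat \<Rightarrow> (nat \<Rightarrow> nat) \<Rightarrow> (nat \<Rightarrow> nat) \<Rightarrow> nat" where
  "num_nodes P rs m = (\<Sum>p=1..P. rs p * m p)"

definition num_groups :: "nat \<Rightarrow> (nat \<Rightarrow> nat) \<Rightarrow> (nat \<Rightarrow> nat) \<Rightarrow> nat" where
  "num_groups P rs m = (\<Prod>p=1..P. m p ^ rs p)"

text \<open>The indices \<open>i\<close> of those sets \<open>KK i\<close> that partition \<open>C p\<close>.\<close>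

definition class_indices :: "(nat \<Rightarrow> nat) \<Rightarrow> nat \<Rightarrow> nat set" where
  "class_indices rs p = {(\<Sum>q=1..<p. rs q) + 1..(\<Sum>q=1..p. rs q)}"

definition node_groups :: "nat \<Rightarrow> nat \<Rightarrow> (nat \<Rightarrow> nat set) \<Rightarrow> nat set set" where
  "node_groups K r KK =
     {S. S \<subseteq> {1..K} \<and> card S = r \<and> (\<forall>i\<in>{1..r}. card (S \<inter> KK i) = 1)}"

text \<open>\<open>G 1, \<dots>, G X\<close> enumerate the node groups without repetition.\<close>

definition node_grouping2 ::
  "nat \<Rightarrow> (nat \<Rightarrow> nat) \<Rightarrow> (nat \<Rightarrow> nat) \<Rightarrow> (nat \<Rightarrow> nat set) \<Rightarrow> (nat \<Rightarrow> nat set) \<Rightarrow> (nat \<Rightarrow> nat set) \<Rightarrow> bool"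
where
  "node_grouping2 P rs m C KK G \<longleftrightarrow>
     indexed_partition {1..P} C {1..num_nodes P rs m} \<and>
     (\<forall>p\<in>{1..P}. indexed_partition (class_indices rs p) KK (C p) \<and>
        (\<forall>i\<in>class_indices rs p. card (KK i) = m p)) \<and>
     bij_betw G {1..num_groups P rs m} (node_groups (num_nodes P rs m) (total_r P rs) KK)"

definition ng_file_mapping ::
  "nat \<Rightarrow> nat \<Rightarrow> nat \<Rightarrow> nat \<Rightarrow> (nat \<Rightarrow> nat set) \<Rightarrow> (nat \<Rightarrow> nat set) \<Rightarrow> (nat \<Rightarrow> nat set) \<Rightarrow> bool"
where
  "ng_file_mapping K X \<eta>1 N G B M \<longleftrightarrow>
     N = \<eta>1 * X \<and>
     indexed_partition {1..X} B {1..N} \<and>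
     (\<forall>i\<in>{1..X}. card (B i) = \<eta>1) \<and>
     (\<forall>k\<in>{1..K}. M k = (\<Union>i\<in>{i\<in>{1..X}. k \<in> G i}. B i))"

definition lcm_pred :: "nat \<Rightarrow> (nat \<Rightarrow> nat) \<Rightarrow> nat" where
  "lcm_pred P m = Lcm ((\<lambda>p. m p - 1) ` {1..P})"

definition weight_sum :: "nat \<Rightarrow> (nat \<Rightarrow> nat) \<Rightarrow> (nat \<Rightarrow> nat) \<Rightarrow> real" where
  "weight_sum P rs m = (\<Sum>p=1..P. real (rs p) * real (m p) / (real (m p) - 1))"

definition function_assignment2 ::
  "nat \<Rightarrow> (nat \<Rightarrow> nat) \<Rightarrow> (nat \<Rightarrow> nat) \<Rightarrow> nat \<Rightarrow> nat \<Rightarrow> (nat \<Rightarrow> nat set) \<Rightarrow> (nat \<Rightarrow> nat set) \<Rightarrow> bool"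
where
  "function_assignment2 P rs m \<eta>2 Q C W \<longleftrightarrow>
     real Q = real \<eta>2 * real (lcm_pred P m) * weight_sum P rs m \<and>
     indexed_partition {1..num_nodes P rs m} W {1..Q} \<and>
     (\<forall>p\<in>{1..P}. \<forall>k\<in>C p.
        real (card (W k)) = real \<eta>2 * real (lcm_pred P m) / (real (m p) - 1))"

text \<open>The communication load of the NG Shuffle Method, in closed form.\<close>

definition ng_shuffle_load :: "nat \<Rightarrow> (nat \<Rightarrow> nat) \<Rightarrow> (nat \<Rightarrow> nat) \<Rightarrow> real" where
  "ng_shuffle_load P rs m =
     1 / (real (total_r P rs) - 1) * (real (total_r P rs) / weight_sum P rs m)"

end

theory Submission
  imports Defs
begin

text \<open>
  The nodes of a single set \<open>KK 1\<close> already force the bound. They hold disjoint sets of files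
  that cover all files, and each has \<open>\<eta>2 Y / (m\<^sub>1 - 1)\<close> functions. Order them arbitrarily and fix
  all IVs except those of a function of a node \<open>k\<close> in a file held neither by \<open>k\<close> nor by an
  earlier node. The broadcasts determine the free IVs, because the nodes can be made to decode one
  after the other, so there are at most as many free bits as broadcast bits. In the sum of this
  bound for an order and for its reverse, each file counts once for every node that does not hold
  it, which gives \<open>2 \<Sum>\<^sub>k \<ell>\<^sub>k \<ge> \<eta>2 Y N T\<close>.
\<close>

section \<open>Support of the IV distribution and decodability\<close>

text \<open>Schemes are constrained only on this support, so with its explicit form the rest of the
  argument is counting, without probability.\<close>

lemma set_iv_pmf:
  "set_pmf (iv_pmf N Q T) = PiE_dflt ({1..Q} \<times> {1..N}) [] (\<lambda>_. {b. length b = T})"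
proof -
  have fin: "finite {b :: bool list. length b = T}"
    using finite_lists_length_eq[of "UNIV :: bool set" T] by simp
  have ne: "{b :: bool list. length b = T} \<noteq> {}"
    using length_replicate[of T False] by blast
  show ?thesis
    unfolding iv_pmf_def by (subst set_Pi_pmf) (simp_all add: set_pmf_of_set[OF ne fin] o_def)
qed

lemma card_bool_lists: "card {b :: bool list. length b = n} = 2 ^ n"
  using card_lists_length_eq[of "UNIV :: bool set" n] by simp

text \<open>A decoder is a function, so equal inputs yield equal outputs. This decoder-free form is
  what the injectivity argument for the lower bound uses.\<close>

lemma shuffle_scheme_determines:
  assumes "shuffle_scheme K N Q T M W len enc" and "k \<in> {1..K}"
    and "v \<in> set_pmf (iv_pmf N Q T)" and "v' \<in> set_pmf (iv_pmf N Q T)"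
    and "broadcasts K Q M enc v = broadcasts K Q M enc v'"
    and "computed_ivs Q M k v = computed_ivs Q M k v'"
    and "i \<in> W k" and "j \<in> {1..N}"
  shows "v (i, j) = v' (i, j)"
proof -
  obtain dec where "\<forall>v\<in>set_pmf (iv_pmf N Q T). \<forall>i\<in>W k. \<forall>j\<in>{1..N}.
      dec (broadcasts K Q M enc v) (computed_ivs Q M k v) (i, j) = v (i, j)"
    using assms(1,2) unfolding shuffle_scheme_def by blast
  then show ?thesis
    using assms(3-8) by metis
qed

text \<open>Broadcasting every computed IV uncoded; without any scheme the infimum in
  \<open>optimal_load\<close> would be over the empty set.\<close>

lemma shuffle_scheme_exists:
  assumes cover: "(\<Union>k\<in>{1..K}. M k) = {1..N}" and W: "\<And>k. k \<in> {1..K} \<Longrightarrow> W k \<subseteq> {1..Q}"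
  shows "\<exists>len enc. shuffle_scheme K N Q T M W len enc"
proof -
  have M: "M k \<subseteq> {1..N}" if "k \<in> {1..K}" for k
    using cover that by blast
  have "\<exists>xs. set xs = {1..Q} \<times> M k" if "k \<in> {1..K}" for k
    using M[OF that] by (intro finite_list finite_cartesian_product) (auto intro: finite_subset)
  then obtain xs where xs: "\<And>k. k \<in> {1..K} \<Longrightarrow> set (xs k) = {1..Q} \<times> M k"
    by metis
  define enc :: "nat \<Rightarrow> iv_family \<Rightarrow> bool list" where "enc k v = concat (map v (xs k))" for k v
  \<comment> \<open>The list \<open>xs k\<close> contains only indices of IVs that node
    \<open>k\<close> computes, so restricting the encoder's input leaves its message
    unchanged.\<close>
  have enc: "broadcasts K Q M enc v k = concat (map v (xs k))" if "k \<in> {1..K}" for v k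
    using that xs[OF that]
    by (auto simp: broadcasts_def enc_def computed_ivs_def intro!: arg_cong[of _ _ concat])
  have len: "length (v x) = T"
    if "v \<in> set_pmf (iv_pmf N Q T)" "k \<in> {1..K}" "x \<in> set (xs k)" for v k x
  proof -
    have "x \<in> {1..Q} \<times> {1..N}"
      using that(3) xs[OF that(2)] M[OF that(2)] by auto
    then show ?thesis
      using that(1) unfolding set_iv_pmf PiE_dflt_def by blast
  qed
  have inj: "v (i, j) = v' (i, j)"
    if v: "v \<in> set_pmf (iv_pmf N Q T)" and v': "v' \<in> set_pmf (iv_pmf N Q T)"
      and eq: "broadcasts K Q M enc v = broadcasts K Q M enc v'"
      and i: "i \<in> {1..Q}" and j: "j \<in> {1..N}" for v v' i j
  proof -
    obtain k where k: "k \<in> {1..K}" "j \<in> M k"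
      using cover j by blast
    have "concat (map v (xs k)) = concat (map v' (xs k))"
      using enc[OF k(1)] eq by metis
    \<comment> \<open>All blocks have length \<open>T\<close>, so the concatenation can be cut up in
      only one way.\<close>
    then have "map v (xs k) = map v' (xs k)"
    proof (rule concat_injective)
      show "\<forall>(y, z)\<in>set (zip (map v (xs k)) (map v' (xs k))). length y = length z"
        using len[OF v k(1) nth_mem] len[OF v' k(1) nth_mem] by (auto simp: set_zip)
    qed simp
    then show ?thesis
      using xs[OF k(1)] i k(2) by auto
  qed
  \<comment> \<open>The decoder ignores the node's own IVs and picks any realisation that explains
    the broadcasts; by \<open>inj\<close> it agrees with the true one at every index.\<close>
  define dec :: "(nat \<Rightarrow> bool list) \<Rightarrow> iv_family \<Rightarrow> iv_family" where
    "dec b c = (SOME v. v \<in> set_pmf (iv_pmf N Q T) \<and> broadcasts K Q M enc v = b)" for b c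
  have dec: "dec (broadcasts K Q M enc v) c (i, j) = v (i, j)"
    if "v \<in> set_pmf (iv_pmf N Q T)" "i \<in> {1..Q}" "j \<in> {1..N}" for v c i j
  proof -
    let ?u = "dec (broadcasts K Q M enc v) c"
    have "?u \<in> set_pmf (iv_pmf N Q T) \<and> broadcasts K Q M enc ?u = broadcasts K Q M enc v"
      unfolding dec_def by (rule someI[of _ v]) (use that in simp)
    then show ?thesis
      using inj that by blast
  qed
  have "shuffle_scheme K N Q T M W (\<lambda>k. T * length (xs k)) enc"
    unfolding shuffle_scheme_def
  proof (intro conjI ballI exI)
    fix k v assume k: "k \<in> {1..K}" and v: "v \<in> set_pmf (iv_pmf N Q T)"
    have "map (length \<circ> v) (xs k) = map (\<lambda>_. T) (xs k)"
      using len[OF v k] by auto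
    then show "length (broadcasts K Q M enc v k) = T * length (xs k)"
      unfolding enc[OF k] length_concat map_map
      by (simp only:) (simp add: sum_list_triv mult.commute)
  next
    fix k v i j
    assume "k \<in> {1..K}" "v \<in> set_pmf (iv_pmf N Q T)" "i \<in> W k" "j \<in> {1..N}"
    then show "dec (broadcasts K Q M enc v) (computed_ivs Q M k v) (i, j) = v (i, j)"
      using W dec by blast
  qed
  then show ?thesis
    by blast
qed

section \<open>Lower bound on the total broadcast length\<close>

text \<open>Letting only the IVs counted on the left vary gives 2 to the power of the left-hand side
  many realisations. Broadcasting is injective on them and takes at most 2 to the power of the
  right-hand side many values. The order \<open>\<rho>\<close> is left open so that an order and its
  reverse can be combined.\<close>

lemma shuffle_length_ge:
  fixes \<rho> :: "nat \<Rightarrow> nat"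
  assumes scheme: "shuffle_scheme K N Q T M W len enc"
    and S: "S \<subseteq> {1..K}" and W: "\<And>k. k \<in> S \<Longrightarrow> W k \<subseteq> {1..Q}"
    and disj: "disjoint_family_on W S"
  shows "T * (\<Sum>k\<in>S. card (W k) * card {j\<in>{1..N}. \<forall>l\<in>S. \<rho> l \<le> \<rho> k \<longrightarrow> j \<notin> M l})
    \<le> (\<Sum>k=1..K. len k)"
proof -
  define F where "F k = {j\<in>{1..N}. \<forall>l\<in>S. \<rho> l \<le> \<rho> k \<longrightarrow> j \<notin> M l}" for k
  define D where "D = (\<Union>k\<in>S. W k \<times> F k)"
  \<comment> \<open>The IVs in \<open>D\<close> range over all strings of \<open>T\<close> bits. The
    others are frozen at a string of the same length, which keeps \<open>E\<close> inside the
    support.\<close>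
  define E where "E = PiE_dflt ({1..Q} \<times> {1..N}) []
    (\<lambda>x. if x \<in> D then {b :: bool list. length b = T} else {replicate T False})"
  have finS: "finite S"
    using S finite_subset by blast
  have D_sub: "D \<subseteq> {1..Q} \<times> {1..N}"
    unfolding D_def F_def using W by blast
  have E_sub: "E \<subseteq> set_pmf (iv_pmf N Q T)"
  proof
    fix v assume v: "v \<in> E"
    have "length (v x) = T" if "x \<in> {1..Q} \<times> {1..N}" for x
    proof -
      have "v x \<in> (if x \<in> D then {b. length b = T} else {replicate T False})"
        using v that unfolding E_def PiE_dflt_def by blast
      then show ?thesis
        by (cases "x \<in> D") simp_all
    qed
    moreover have "v x = []" if "x \<notin> {1..Q} \<times> {1..N}" for x
      using v that unfolding E_def PiE_dflt_def by blast
    ultimately show "v \<in> set_pmf (iv_pmf N Q T)"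
      unfolding set_iv_pmf PiE_dflt_def by blast
  qed
  have finW: "finite (W k)" if "k \<in> S" for k
    using W[OF that] finite_subset by blast
  have cardD: "card D = (\<Sum>k\<in>S. card (W k) * card (F k))"
    unfolding D_def
  proof (subst card_UN_disjoint)
    show "\<forall>k\<in>S. finite (W k \<times> F k)"
      using finW by (auto simp: F_def)
    show "\<forall>k\<in>S. \<forall>l\<in>S. k \<noteq> l \<longrightarrow> (W k \<times> F k) \<inter> (W l \<times> F l) = {}"
      using disj unfolding disjoint_family_on_def by blast
  qed (simp_all add: finS card_cartesian_product)
  have cardE: "card E = 2 ^ (T * card D)"
  proof -
    have "card E = (\<Prod>x\<in>{1..Q} \<times> {1..N}. card (if x \<in> D then {b :: bool list. length b = T}
      else {replicate T False}))"
      unfolding E_def by (rule card_PiE_dflt)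
        (use finite_lists_length_eq[of "UNIV :: bool set" T] in auto)
    also have "\<dots> = (\<Prod>x\<in>{1..Q} \<times> {1..N}. if x \<in> D then 2 ^ T else 1)"
      by (intro prod.cong refl) (simp add: card_bool_lists)
    also have "\<dots> = (\<Prod>x\<in>D. 2 ^ T)"
      using D_sub by (subst prod.inter_restrict[symmetric]) (simp_all add: Int_absorb1)
    finally show ?thesis
      by (simp add: power_mult)
  qed
  have inj: "inj_on (broadcasts K Q M enc) E"
  proof (rule inj_onI)
    fix v v' assume v: "v \<in> E" and v': "v' \<in> E"
      and eq: "broadcasts K Q M enc v = broadcasts K Q M enc v'"
    have outside: "v x = v' x" if "x \<notin> D" for x
    proof -
      have "u x = (if x \<in> {1..Q} \<times> {1..N} then replicate T False else [])" if "u \<in> E" for u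
      proof (cases "x \<in> {1..Q} \<times> {1..N}")
        case True
        then have "u x \<in> (if x \<in> D then {b. length b = T} else {replicate T False})"
          using that unfolding E_def PiE_dflt_def by blast
        then show ?thesis
          using True \<open>x \<notin> D\<close> by simp
      next
        case False
        then have "u x = []"
          using that unfolding E_def PiE_dflt_def by blast
        then show ?thesis
          using False by (simp only: if_False)
      qed
      then show ?thesis
        using v v' by metis
    qed
    \<comment> \<open>Induction along \<open>\<rho>\<close>: the free IVs that node \<open>k\<close>
      computes belong to functions of earlier nodes, which are already decoded. Hence both
      realisations look the same to \<open>k\<close>, and its own functions are determined
      too.\<close>
    have step: "\<forall>i\<in>W k. \<forall>j\<in>{1..N}. v (i, j) = v' (i, j)" if "k \<in> S" for k
      using that
    proof (induction k rule: measure_induct_rule[of \<rho>])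
      case (less k)
      have "v (i, j) = v' (i, j)" if ij: "i \<in> {1..Q}" "j \<in> M k" for i j
      proof (cases "(i, j) \<in> D")
        case True
        then obtain l where l: "l \<in> S" "i \<in> W l" "j \<in> F l"
          unfolding D_def by blast
        \<comment> \<open>Otherwise \<open>\<rho> k \<le> \<rho> l\<close>, and
          \<open>j \<in> F l\<close> would rule out \<open>j \<in> M k\<close>.\<close>
        then have "\<rho> l < \<rho> k"
          using ij less.prems unfolding F_def by force
        then show ?thesis
          using less.IH[of l] l unfolding F_def by blast
      qed (rule outside)
      then have "computed_ivs Q M k v = computed_ivs Q M k v'"
        unfolding computed_ivs_def by (intro restrict_ext) auto
      then show ?case
        using shuffle_scheme_determines[OF scheme _ _ _ eq] S less.prems v v' E_sub by blast
    qed
    show "v = v'"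
    proof
      fix x show "v x = v' x"
        using step outside[of x] unfolding D_def F_def by (cases "x \<in> D") (auto simp: D_def F_def)
    qed
  qed
  \<comment> \<open>Messages are undefined outside the actual nodes, so the broadcasts lie in a
    finite product whose size is governed by the lengths alone.\<close>
  let ?R = "PiE {1..K} (\<lambda>k. {b :: bool list. length b = len k})"
  have "broadcasts K Q M enc ` E \<subseteq> ?R"
    using scheme E_sub unfolding shuffle_scheme_def by (auto simp: broadcasts_def)
  moreover have "finite ?R"
    by (intro finite_PiE) (use finite_lists_length_eq[of "UNIV :: bool set"] in auto)
  ultimately have "card E \<le> card ?R"
    using inj by (metis card_image card_mono)
  also have "card ?R = 2 ^ (\<Sum>k=1..K. len k)"
    by (simp add: card_PiE card_bool_lists power_sum)
  finally show ?thesis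
    by (simp add: cardE cardD F_def)
qed

text \<open>A file with holder \<open>h j\<close> contributes once for each node of \<open>S\<close>
  that precedes \<open>h j\<close>. An order and its reverse together count every node of
  \<open>S\<close> except \<open>h j\<close>, hence the factors \<open>card S - 1\<close> and
  2.\<close>

lemma shuffle_length_ge_of_file_partition:
  assumes scheme: "shuffle_scheme K N Q T M W len enc"
    and S: "S \<subseteq> {1..K}" and W: "\<And>k. k \<in> S \<Longrightarrow> W k \<subseteq> {1..Q}"
    and disj: "disjoint_family_on W S" and cardW: "\<And>k. k \<in> S \<Longrightarrow> card (W k) = w"
    and part: "\<And>j. j \<in> {1..N} \<Longrightarrow> \<exists>!k. k \<in> S \<and> j \<in> M k"
  shows "T * w * (card S - 1) * N \<le> 2 * (\<Sum>k=1..K. len k)"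
proof -
  have finS: "finite S"
    using S finite_subset by blast
  obtain h where h: "\<And>j. j \<in> {1..N} \<Longrightarrow> h j \<in> S \<and> j \<in> M (h j)"
    using part by metis
  have h_unique: "k = h j" if "j \<in> {1..N}" "k \<in> S" "j \<in> M k" for j k
    using part[OF that(1)] h[OF that(1)] that by blast
  have bound: "T * w * (\<Sum>j=1..N. card {k\<in>S. \<rho> k < \<rho> (h j)}) \<le> (\<Sum>k=1..K. len k)"
    for \<rho> :: "nat \<Rightarrow> nat"
  proof -
    have "{j\<in>{1..N}. \<forall>l\<in>S. \<rho> l \<le> \<rho> k \<longrightarrow> j \<notin> M l} = {j\<in>{1..N}. \<rho> k < \<rho> (h j)}" for k
    proof -
      have "(\<forall>l\<in>S. \<rho> l \<le> \<rho> k \<longrightarrow> j \<notin> M l) \<longleftrightarrow> \<rho> k < \<rho> (h j)" if "j \<in> {1..N}" for j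
        using h[OF that] h_unique[OF that] by (metis linorder_not_less)
      then show ?thesis
        by blast
    qed
    moreover have "(\<Sum>k\<in>S. card {j\<in>{1..N}. \<rho> k < \<rho> (h j)})
        = (\<Sum>j=1..N. card {k\<in>S. \<rho> k < \<rho> (h j)})"
      using sum.swap_restrict[OF finS finite_atLeastAtMost[of 1 N],
        of "\<lambda>_ _. 1 :: nat" "\<lambda>k j. \<rho> k < \<rho> (h j)"] by simp
    ultimately show ?thesis
      using shuffle_length_ge[OF scheme S W disj, of \<rho>] cardW
      by (simp add: sum_distrib_left[symmetric] mult.assoc)
  qed
  \<comment> \<open>The map \<open>K - k\<close> reverses the order; truncated subtraction does no
    harm because \<open>S\<close> and \<open>h j\<close> lie within \<open>{1..K}\<close>.\<close>
  have split: "card {k\<in>S. k < h j} + card {k\<in>S. K - k < K - h j} = card S - 1"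
    if "j \<in> {1..N}" for j
  proof -
    have "{k\<in>S. K - k < K - h j} = {k\<in>S. h j < k}"
      using S h[OF that] by auto
    moreover have "{k\<in>S. k < h j} \<union> {k\<in>S. h j < k} = S - {h j}"
      by auto
    moreover have "card ({k\<in>S. k < h j} \<union> {k\<in>S. h j < k})
        = card {k\<in>S. k < h j} + card {k\<in>S. h j < k}"
      by (rule card_Un_disjoint) (use finS in auto)
    ultimately show ?thesis
      using h[OF that] by simp
  qed
  have "T * w * (card S - 1) * N
      = T * w * (\<Sum>j=1..N. card {k\<in>S. k < h j} + card {k\<in>S. K - k < K - h j})"
    by (simp add: split)
  also have "\<dots> \<le> 2 * (\<Sum>k=1..K. len k)"
    using bound[of "\<lambda>k. k"] bound[of "\<lambda>k. K - k"] by (simp add: sum.distrib distrib_left)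
  finally show ?thesis .
qed

section \<open>Application to the hypercuboid design\<close>

theorem theorem5:
  fixes P \<eta>1 \<eta>2 T N Q :: nat
    and rs m :: "nat \<Rightarrow> nat"
    and C KK G B M W :: "nat \<Rightarrow> nat set"
  assumes "P \<ge> 1"
    and "\<And>p. p \<in> {1..P} \<Longrightarrow> rs p \<ge> 1"
    and "\<And>p. p \<in> {1..P} \<Longrightarrow> m p \<ge> 2"
    and "\<eta>1 \<ge> 1" and "\<eta>2 \<ge> 1" and "T \<ge> 1"
    and "total_r P rs \<ge> 2"
    and "node_grouping2 P rs m C KK G"
    and "ng_file_mapping (num_nodes P rs m) (num_groups P rs m) \<eta>1 N G B M"
    and "function_assignment2 P rs m \<eta>2 Q C W"
  shows "ng_shuffle_load P rs m
    \<le> 2 * real (total_r P rs) / (real (total_r P rs) - 1)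
        * optimal_load (num_nodes P rs m) N Q T M W"
proof -
  let ?K = "num_nodes P rs m" and ?X = "num_groups P rs m"
  let ?Y = "lcm_pred P m" and ?w = "weight_sum P rs m" and ?S = "KK 1"
  have rs1: "rs 1 \<ge> 1" and m1: "m 1 \<ge> 2" and one: "1 \<in> {1..P}"
    using assms(1-3) by auto
  have one_class: "1 \<in> class_indices rs 1"
    using rs1 by (simp add: class_indices_def)
  have C1: "C 1 \<subseteq> {1..?K}"
    using assms(8) one unfolding node_grouping2_def indexed_partition_def by blast
  have SC: "?S \<subseteq> C 1" and cardS: "card ?S = m 1"
    using assms(8) one one_class unfolding node_grouping2_def indexed_partition_def by blast+
  have S: "?S \<subseteq> {1..?K}"
    using SC C1 by blast
  have group: "card (G a \<inter> ?S) = 1" if "a \<in> {1..?X}" for a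
  proof -
    have "G a \<in> node_groups ?K (total_r P rs) KK"
      using assms(8) that unfolding node_grouping2_def bij_betw_def by blast
    then show ?thesis
      using assms(7) unfolding node_groups_def by auto
  qed
  have M: "M k = (\<Union>i\<in>{i\<in>{1..?X}. k \<in> G i}. B i)" if "k \<in> {1..?K}" for k
    using assms(9) that unfolding ng_file_mapping_def by blast
  have B: "disjoint_family_on B {1..?X}" "(\<Union>i\<in>{1..?X}. B i) = {1..N}"
    using assms(9) unfolding ng_file_mapping_def indexed_partition_def by blast+
  \<comment> \<open>The holders of a file in \<open>B a\<close> are the members of the group
    \<open>G a\<close>, and a group meets \<open>KK 1\<close> in exactly one node.\<close>
  have part: "\<exists>!k. k \<in> ?S \<and> j \<in> M k" if j: "j \<in> {1..N}" for j
  proof -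
    obtain a where a: "a \<in> {1..?X}" "j \<in> B a"
      using B(2) j by blast
    then have a_unique: "b = a" if "b \<in> {1..?X}" "j \<in> B b" for b
      using B(1) that unfolding disjoint_family_on_def by blast
    have owner: "j \<in> M k \<longleftrightarrow> k \<in> G a" if "k \<in> ?S" for k
      using M[of k] S that a a_unique by blast
    obtain x where "G a \<inter> ?S = {x}"
      using group[OF a(1)] card_1_singletonE by blast
    then have "k \<in> ?S \<and> j \<in> M k \<longleftrightarrow> k = x" for k
      using owner[of k] by blast
    then show ?thesis
      by simp
  qed
  have W: "disjoint_family_on W {1..?K}" "(\<Union>k\<in>{1..?K}. W k) = {1..Q}"
    using assms(10) unfolding function_assignment2_def indexed_partition_def by blast+
  have W_sub: "W k \<subseteq> {1..Q}" if "k \<in> {1..?K}" for k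
    using W(2) that by blast
  have cover: "(\<Union>k\<in>{1..?K}. M k) = {1..N}"
  proof
    show "(\<Union>k\<in>{1..?K}. M k) \<subseteq> {1..N}"
      using M B(2) by blast
    show "{1..N} \<subseteq> (\<Union>k\<in>{1..?K}. M k)"
      using part S by blast
  qed
  have w_pos: "?w > 0"
    unfolding weight_sum_def using one
  proof (intro sum_pos)
    fix p assume "p \<in> {1..P}"
    then show "real (rs p) * real (m p) / (real (m p) - 1) > 0"
      using assms(2,3)[of p] by (intro divide_pos_pos mult_pos_pos) auto
  qed auto
  have Y_pos: "?Y > 0"
  proof -
    have "?Y \<noteq> 0"
      unfolding lcm_pred_def by (subst Lcm_0_iff) (use assms(3) in force)+
    then show ?thesis
      by simp
  qed
  have Q_eq: "real Q = real \<eta>2 * real ?Y * ?w"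
    using assms(10) unfolding function_assignment2_def by blast
  have Q_pos: "real Q > 0"
    unfolding Q_eq using w_pos Y_pos assms(5) by simp
  have N_pos: "real N > 0"
  proof -
    have "?X > 0"
      unfolding num_groups_def by (intro prod_pos zero_less_power) (use assms(3) in force)
    then show ?thesis
      using assms(4,9) unfolding ng_file_mapping_def by simp
  qed
  have cardW: "real (card (W k)) = real \<eta>2 * real ?Y / (real (m 1) - 1)" if "k \<in> ?S" for k
    using assms(10) one SC that unfolding function_assignment2_def by blast
  \<comment> \<open>The factor \<open>m 1 - 1\<close> cancels the denominator of
    \<open>card (W k)\<close>, leaving \<open>\<eta>2 * ?Y\<close>, which is \<open>Q / ?w\<close>.
    The bound therefore does not depend on which class the chosen nodes come from.\<close>
  have load: "1 / (2 * ?w) \<le> comm_load ?K N Q T len"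
    if scheme: "shuffle_scheme ?K N Q T M W len enc" for len enc
  proof -
    obtain k where k: "k \<in> ?S"
      using cardS m1 by fastforce
    have const: "card (W l) = card (W k)" if "l \<in> ?S" for l
      using cardW[OF that] cardW[OF k] by (metis of_nat_eq_iff)
    have "T * card (W k) * (card ?S - 1) * N \<le> 2 * (\<Sum>k=1..?K. len k)"
    proof (rule shuffle_length_ge_of_file_partition[OF scheme S _ _ const part])
      show "disjoint_family_on W ?S"
        using W(1) S by (rule disjoint_family_on_mono[rotated])
    qed (use W_sub S in blast)+
    then have "real (T * card (W k) * (m 1 - 1) * N) \<le> real (2 * (\<Sum>k=1..?K. len k))"
      unfolding cardS of_nat_le_iff .
    then have "real T * real N * (real (card (W k)) * (real (m 1) - 1))
        \<le> 2 * (\<Sum>k=1..?K. real (len k))"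
      using m1 by (simp add: of_nat_diff mult_ac)
    also have "real (card (W k)) * (real (m 1) - 1) = real \<eta>2 * real ?Y"
      using cardW[OF k] m1 by simp
    also have "\<dots> = real Q / ?w"
      using Q_eq w_pos by simp
    finally show ?thesis
      using Q_pos N_pos w_pos assms(6) unfolding comm_load_def by (simp add: field_simps)
  qed
  have "1 / (2 * ?w) \<le> optimal_load ?K N Q T M W"
    unfolding optimal_load_def
    using shuffle_scheme_exists[OF cover W_sub] load
    by (intro cInf_greatest) auto
  moreover have "0 \<le> 2 * real (total_r P rs) / (real (total_r P rs) - 1)"
    using assms(7) by simp
  \<comment> \<open>With r for \<open>total_r P rs\<close>, the left-hand side is r / ((r - 1)
    \<open>?w\<close>), exactly the load of the NG Shuffle Method.\<close>
  ultimately have "2 * real (total_r P rs) / (real (total_r P rs) - 1) * (1 / (2 * ?w))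
      \<le> 2 * real (total_r P rs) / (real (total_r P rs) - 1) * optimal_load ?K N Q T M W"
    by (rule mult_left_mono)
  then show ?thesis
    unfolding ng_shuffle_load_def by simp
qed

end
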